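(* Let $n\ge 2$ be an integer, $u>0$ a real number, and $t\ge 1$ an integer. Suppose $\Theta$ is uniformly distributed on $\Delta^{n,u}$. Then $$\mathbb{E}\big[\max(\Theta)^t\big]=\frac{u^t}{\binom{n-1+t}{t}}\,f(n,t),\qquad\text{where } f(n,t)=\sum_{k=1}^{n}(-1)^{k-1}\binom{n}{k}\frac{1}{k^{t}}.$$ In particular, $$\mathbb{E}[\max(\Theta)]=\frac{u}{n}\sum_{k=1}^{n}\frac{1}{k}\quad\text{and}\quad \mathrm{Var}(\max(\Theta))=\frac{u^{2}}{n^{2}(n+1)}\left(n\sum_{k=1}^{n}\frac{1}{k^{2}}-\Big(\sum_{k=1}^{n}\frac{1}{k}\Big)^{2}\right).$$
   Context: For an integer $n$ and real $u>0$, the $n$-simplex of size $u$ is $\Delta^{n,u}=\{(\theta_1,\ldots,\theta_n)\in\mathbb{R}^n : \theta_1+\cdots+\theta_n=u,\ \theta_i\ge 0 \text{ for } 1\le i\le n\}$. A random vector $\Theta=(\Theta_1,\ldots,\Theta_n)$ is uniformly distributed on $\Delta^{n,u}$, written $\Theta\sim\mathcal{U}(\Delta^{n,u})$, if $\mathbb{P}(\Theta\in C)=\mathrm{Vol}(C)/\mathrm{Vol}(\Delta^{n,u})$ for every measurable $C\subseteq\Delta^{n,u}$, where $\mathrm{Vol}$ is the $(n-1)$-dimensional volume. The random variable $\max(\Theta)$ is $\max_{1\le i\le n}\Theta_i$. *)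

theory Defs
  imports "HOL-Probability.Probability"
begin

text \<open>
  The k-dimensional volume of a subset of a Euclidean space is its k-dimensional Hausdorff measure.
  The factor \<^term>\<open>unit_ball_vol k / 2 ^ k\<close> is the usual normalisation for which
  it agrees with k-dimensional Lebesgue measure on k-dimensional affine subspaces.
  Boundedness of the covering sets is required explicitly because
  \<^const>\<open>diameter\<close> is only meaningful for bounded sets, and empty covering sets are
  given weight 0 since the formula would otherwise give them weight 1 for k = 0.
\<close>

definition hausdorff_pre :: "nat \<Rightarrow> real \<Rightarrow> 'a::metric_space set \<Rightarrow> ennreal" where
  "hausdorff_pre k \<delta> S =
     (INF U \<in> {U :: nat \<Rightarrow> 'a set. S \<subseteq> (\<Union>i. U i) \<and> (\<forall>i. bounded (U i) \<and> diameter (U i) \<le> \<delta>)}.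
        \<Sum>i. if U i = {} then 0
             else ennreal (unit_ball_vol (real k) * (diameter (U i) / 2) ^ k))"

definition volume_dim :: "nat \<Rightarrow> 'a::metric_space set \<Rightarrow> ennreal" where
  "volume_dim k S = (SUP \<delta> \<in> {0<..}. hausdorff_pre k \<delta> S)"

definition sized_simplex :: "real \<Rightarrow> (real ^ 'n) set" where
  "sized_simplex u = {\<theta>. (\<Sum>i\<in>UNIV. \<theta> $ i) = u \<and> (\<forall>i. 0 \<le> \<theta> $ i)}"

definition uniform_on_simplex :: "'w measure \<Rightarrow> real \<Rightarrow> ('w \<Rightarrow> real ^ 'n) \<Rightarrow> bool" where
  "uniform_on_simplex M u \<Theta> \<longleftrightarrow>
     \<Theta> \<in> borel_measurable M \<and>
     (\<forall>C \<in> sets borel. C \<subseteq> sized_simplex u \<longrightarrow>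
        emeasure M {\<omega> \<in> space M. \<Theta> \<omega> \<in> C} =
          volume_dim (CARD('n) - 1) C / volume_dim (CARD('n) - 1) (sized_simplex u :: (real ^ 'n) set))"

definition max_coord :: "real ^ 'n \<Rightarrow> real" where
  "max_coord \<theta> = Max (range (\<lambda>i. \<theta> $ i))"

definition alt_binom_sum :: "nat \<Rightarrow> nat \<Rightarrow> real" where
  "alt_binom_sum n t = (\<Sum>k=1..n. (-1) ^ (k - 1) * real (n choose k) * (1 / real k ^ t))"

end

theory Submission
  imports Defs
begin

text \<open>
  The maximum of a uniform point of the simplex is understood through its tail. Fix a set
  \<open>A\<close> of \<open>j\<close> coordinates and a level \<open>x\<close> with
  \<open>j * x < u\<close>. The points of the simplex all of whose coordinates in \<open>A\<close> are
  at least \<open>x\<close> form a translate of the simplex of size \<open>u - j * x\<close>, hence a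
  homothetic copy of the full simplex with ratio \<open>1 - j * x / u\<close>. Since
  \<open>(n - 1)\<close>-dimensional volume is translation invariant and homogeneous, this event has
  probability \<open>(1 - j * x / u) ^ (n - 1)\<close> (\<open>uniform_on_simplex_prob_coords_ge\<close>).
  Inclusion-exclusion over the coordinates expresses the probability that the maximum is at least
  \<open>x\<close> as an alternating sum of such powers (\<open>uniform_on_simplex_prob_max_ge\<close>).
  Integrating this tail against \<open>t * x ^ (t - 1)\<close> gives the \<open>t\<close>-th moment,
  and each summand becomes a Beta integral.

  The law of \<open>\<Theta>\<close> supplies countable additivity, so only two facts about the
  Hausdorff volume enter. One is its behaviour under homotheties (\<open>volume_dim_affinity\<close>),
  which is visible from the definition. The other is that the volume of the simplex is finite and
  positive, as the quotient defining the uniform distribution would otherwise be degenerate.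
  Finiteness comes from a grid cover (\<open>volume_dim_simplex_finite\<close>) and positivity from
  comparing a thickened simplex with Lebesgue measure in the ambient space
  (\<open>volume_dim_simplex_pos\<close>).

  The mean and the variance are the cases \<open>t = 1\<close> and \<open>t = 2\<close>, in which the
  recursion \<open>alt_binom_sum_Suc_Suc\<close> evaluates the alternating sum in terms of harmonic
  numbers.
\<close>

section \<open>Volume under homotheties and the volume of the simplex\<close>

text \<open>
  Any cover of \<open>S\<close> is carried by \<open>f\<close> to a cover of the image in which each
  diameter has grown by a factor of at most \<open>L\<close>, so each weight by at most \<open>L ^ k\<close>.
\<close>

lemma volume_dim_lipschitz_image:
  fixes f :: "'a::metric_space \<Rightarrow> 'b::metric_space"
  assumes lip: "L-lipschitz_on S f" and L: "L > 0"
  shows "volume_dim k (f ` S) \<le> ennreal (L ^ k) * volume_dim k S"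
proof -
  have pre: "hausdorff_pre k (L * \<delta>) (f ` S) \<le> ennreal (L ^ k) * hausdorff_pre k \<delta> S" if "\<delta> > 0" for \<delta>
  proof -
    let ?w = "\<lambda>U::'a set. if U = {} then 0 else ennreal (unit_ball_vol (real k) * (diameter U / 2) ^ k)"
    let ?w' = "\<lambda>U::'b set. if U = {} then 0 else ennreal (unit_ball_vol (real k) * (diameter U / 2) ^ k)"
    have "hausdorff_pre k (L * \<delta>) (f ` S) / ennreal (L ^ k) \<le> (\<Sum>i. ?w (U i))"
      if U: "S \<subseteq> (\<Union>i. U i)" "\<forall>i. bounded (U i) \<and> diameter (U i) \<le> \<delta>" for U :: "nat \<Rightarrow> 'a set"
    proof -
      \<comment> \<open>The cover must first be cut down to \<open>S\<close>, since \<open>f\<close> is controlled only there.\<close>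
      define W where "W i = f ` (U i \<inter> S)" for i
      have dist_W: "dist a b \<le> L * diameter (U i)" if "a \<in> W i" "b \<in> W i" for a b i
      proof -
        from that obtain x y where xy: "x \<in> U i" "x \<in> S" "a = f x" "y \<in> U i" "y \<in> S" "b = f y"
          by (auto simp: W_def)
        have "dist a b \<le> L * dist x y" using lipschitz_onD[OF lip] xy by auto
        also have "\<dots> \<le> L * diameter (U i)"
          using L diameter_bounded_bound[of "U i" x y] U(2) xy by auto
        finally show ?thesis .
      qed
      have bounded_W: "bounded (W i)" for i
        using dist_W by (auto simp: bounded_two_points)
      have nonneg: "0 \<le> L * diameter (U i)" for i
        using L U(2) diameter_ge_0[of "U i"] by auto
      have diam_W: "diameter (W i) \<le> L * diameter (U i)" for i
      proof (cases "W i = {}")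
        case False
        then have "diameter (W i) = (SUP (a, b) \<in> W i \<times> W i. dist a b)"
          by (simp add: diameter_def)
        also have "\<dots> \<le> L * diameter (U i)"
          by (rule cSUP_least) (use False dist_W in auto)
        finally show ?thesis .
      qed (use nonneg in simp)
      have "diameter (W i) \<le> L * \<delta>" for i
        using order_trans[OF diam_W[of i]] U(2) L by (meson mult_left_mono less_imp_le)
      moreover have "f ` S \<subseteq> (\<Union>i. W i)" using U(1) by (fastforce simp: W_def)
      ultimately have "hausdorff_pre k (L * \<delta>) (f ` S) \<le> (\<Sum>i. ?w' (W i))"
        unfolding hausdorff_pre_def by (intro INF_lower) (use bounded_W in auto)
      also have "\<dots> \<le> (\<Sum>i. ennreal (L ^ k) * ?w (U i))"
      proof (intro suminf_le allI)
        fix i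
        have "unit_ball_vol (real k) * (diameter (W i) / 2) ^ k
              \<le> unit_ball_vol (real k) * (L * diameter (U i) / 2) ^ k"
          using diam_W[of i] bounded_W[of i] diameter_ge_0
          by (intro mult_left_mono power_mono) auto
        also have "\<dots> = L ^ k * (unit_ball_vol (real k) * (diameter (U i) / 2) ^ k)"
          by (simp add: power_mult_distrib power_divide)
        finally show "?w' (W i) \<le> ennreal (L ^ k) * ?w (U i)"
          using L by (auto simp: W_def simp flip: ennreal_mult'' ennreal_mult' intro: ennreal_leI)
      qed auto
      also have "\<dots> = ennreal (L ^ k) * (\<Sum>i. ?w (U i))"
        by (rule ennreal_suminf_cmult)
      finally show ?thesis
        using L by (intro divide_le_posI_ennreal) (auto simp: mult.commute)
    qed
    then have "hausdorff_pre k (L * \<delta>) (f ` S) / ennreal (L ^ k) \<le> hausdorff_pre k \<delta> S"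
      unfolding hausdorff_pre_def[of k \<delta> S] by (intro INF_greatest) auto
    then have "ennreal (L ^ k) * (hausdorff_pre k (L * \<delta>) (f ` S) / ennreal (L ^ k))
               \<le> ennreal (L ^ k) * hausdorff_pre k \<delta> S"
      by (rule mult_left_mono) simp
    moreover have "ennreal (L ^ k) * (H / ennreal (L ^ k)) = H" for H
      using L mult_divide_eq_ennreal[of "ennreal (L ^ k)" H]
      by (simp add: ennreal_times_divide mult.commute[of "ennreal (L ^ k)"])
    ultimately show ?thesis by simp
  qed
  show ?thesis
    unfolding volume_dim_def[of k "f ` S"]
  proof (intro SUP_least)
    fix \<delta> :: real assume "\<delta> \<in> {0<..}"
    then have "hausdorff_pre k (L * (\<delta> / L)) (f ` S) \<le> ennreal (L ^ k) * hausdorff_pre k (\<delta> / L) S"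
      using L by (intro pre) auto
    also have "\<dots> \<le> ennreal (L ^ k) * volume_dim k S"
      unfolding volume_dim_def using L \<open>\<delta> \<in> {0<..}\<close> by (intro mult_left_mono SUP_upper) auto
    finally show "hausdorff_pre k \<delta> (f ` S) \<le> ennreal (L ^ k) * volume_dim k S"
      using L by simp
  qed
qed

text \<open>
  A homothety is Lipschitz with constant \<open>r\<close> and its inverse with constant
  \<open>1 / r\<close>. Together the two bounds leave no slack, so translation invariance and
  homogeneity of degree \<open>k\<close> both follow.
\<close>

lemma volume_dim_affinity:
  fixes S :: "'a::real_normed_vector set"
  assumes r: "r > 0"
  shows "volume_dim k ((\<lambda>x. a + r *\<^sub>R x) ` S) = ennreal (r ^ k) * volume_dim k S"
proof (rule antisym)
  have dist: "dist (c + s *\<^sub>R x) (c + s *\<^sub>R y) = s * dist x y" if "s > 0" for s and c x y :: 'a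
    using that by (simp add: dist_norm flip: scaleR_diff_right)
  show "volume_dim k ((\<lambda>x. a + r *\<^sub>R x) ` S) \<le> ennreal (r ^ k) * volume_dim k S"
    by (intro volume_dim_lipschitz_image lipschitz_onI) (use r dist in auto)
  let ?T = "(\<lambda>x. a + r *\<^sub>R x) ` S"
  have "(\<lambda>y. (- (1/r) *\<^sub>R a) + (1/r) *\<^sub>R y) ` ?T = S"
    using r by (simp add: image_image scaleR_right_distrib)
  moreover have "volume_dim k ((\<lambda>y. (- (1/r) *\<^sub>R a) + (1/r) *\<^sub>R y) ` ?T) \<le> ennreal ((1/r) ^ k) * volume_dim k ?T"
  proof (intro volume_dim_lipschitz_image lipschitz_onI)
    fix x y
    show "dist (- (1/r) *\<^sub>R a + (1/r) *\<^sub>R x) (- (1/r) *\<^sub>R a + (1/r) *\<^sub>R y) \<le> 1/r * dist x y"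
      using dist[of "1/r" "- (1/r) *\<^sub>R a" x y] r by (metis order_refl zero_less_divide_1_iff)
  qed (use r in auto)
  ultimately have "ennreal (r ^ k) * volume_dim k S \<le> ennreal (r ^ k) * (ennreal ((1/r) ^ k) * volume_dim k ?T)"
    by (intro mult_left_mono) auto
  also have "\<dots> = volume_dim k ?T"
    using r by (simp add: power_divide flip: mult.assoc ennreal_mult)
  finally show "ennreal (r ^ k) * volume_dim k S \<le> volume_dim k ?T" .
qed

text \<open>
  An upper bound for the volume needs only finite covers, one at each scale, for which the number
  of pieces times the \<open>k\<close>-th power of the mesh stays bounded.
\<close>

lemma volume_dim_le_of_fine_covers:
  fixes S :: "'a::metric_space set"
  assumes "\<And>\<delta>. \<delta> > 0 \<Longrightarrow> \<exists>F d. finite F \<and> S \<subseteq> \<Union>F \<and> d \<le> \<delta> \<and> real (card F) * d ^ k \<le> C \<and>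
                     (\<forall>U\<in>F. bounded U \<and> diameter U \<le> d)"
  shows "volume_dim k S \<le> ennreal (unit_ball_vol (real k) * C)"
  unfolding volume_dim_def
proof (intro SUP_least)
  fix \<delta> :: real assume \<delta>: "\<delta> \<in> {0<..}"
  then obtain F d where F: "finite F" "S \<subseteq> \<Union>F" "d \<le> \<delta>" "real (card F) * d ^ k \<le> C"
    "\<And>U. U \<in> F \<Longrightarrow> bounded U" "\<And>U. U \<in> F \<Longrightarrow> diameter U \<le> d"
    using assms[of \<delta>] by auto
  obtain g where g: "bij_betw g {..<card F} F"
    using ex_bij_betw_nat_finite[OF F(1)] by (auto simp: atLeast0LessThan)
  define U where "U i = (if i < card F then g i else {})" for i
  have gF: "g i \<in> F" if "i < card F" for i
    using g that by (auto simp: bij_betw_def)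
  have cov: "S \<subseteq> (\<Union>i. U i)"
  proof
    fix x assume "x \<in> S"
    then obtain V where "V \<in> F" "x \<in> V" using F(2) by blast
    then obtain i where "i < card F" "g i = V"
      using g unfolding bij_betw_def by (metis imageE lessThan_iff)
    then show "x \<in> (\<Union>i. U i)" using \<open>x \<in> V\<close> by (auto simp: U_def intro!: exI[of _ i])
  qed
  have UN: "\<forall>i. bounded (U i) \<and> diameter (U i) \<le> \<delta>"
    using gF F(3,5,6) \<delta> by (force simp: U_def intro: order_trans)
  let ?w = "\<lambda>i. if U i = {} then 0 else ennreal (unit_ball_vol (real k) * (diameter (U i) / 2) ^ k)"
  have "hausdorff_pre k \<delta> S \<le> (\<Sum>i. ?w i)"
    unfolding hausdorff_pre_def by (intro INF_lower) (use cov UN in auto)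
  also have "\<dots> = (\<Sum>i<card F. ?w i)"
    by (intro suminf_finite) (auto simp: U_def)
  also have "\<dots> \<le> (\<Sum>i<card F. ennreal (unit_ball_vol (real k) * d ^ k))"
  proof (intro sum_mono)
    fix i assume i: "i \<in> {..<card F}"
    then have "diameter (U i) / 2 \<le> d" "0 \<le> diameter (U i)"
      using F(5,6)[OF gF[of i]] diameter_ge_0[of "U i"] by (auto simp: U_def)
    then show "?w i \<le> ennreal (unit_ball_vol (real k) * d ^ k)"
      by (auto intro!: ennreal_leI mult_left_mono power_mono)
  qed
  also have "\<dots> = ennreal (unit_ball_vol (real k) * (real (card F) * d ^ k))"
  proof (cases "card F = 0")
    case False
    then obtain U where "U \<in> F" by (metis all_not_in_conv card.empty)
    then have "0 \<le> d" using F(5,6) diameter_ge_0 by (meson order_trans)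
    then show ?thesis
      by (simp add: ennreal_of_nat_eq_real_of_nat mult_ac flip: ennreal_mult')
  qed simp
  also have "\<dots> \<le> ennreal (unit_ball_vol (real k) * C)"
    using F(4) by (intro ennreal_leI mult_left_mono) auto
  finally show "hausdorff_pre k \<delta> S \<le> ennreal (unit_ball_vol (real k) * C)" .
qed

lemma sized_simplex_coord_bounds:
  assumes "\<theta> \<in> sized_simplex u"
  shows "0 \<le> \<theta> $ i" "\<theta> $ i \<le> u"
  using assms member_le_sum[of i UNIV "\<lambda>i. \<theta> $ i"] by (auto simp: sized_simplex_def)

lemma bounded_sized_simplex: "bounded (sized_simplex u :: (real ^ 'n) set)"
proof (rule boundedI)
  fix \<theta> :: "real ^ 'n" assume *: "\<theta> \<in> sized_simplex u"
  have "norm \<theta> \<le> (\<Sum>i\<in>UNIV. \<bar>\<theta> $ i\<bar>)" by (rule norm_le_l1_cart)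
  also have "\<dots> = u" using * by (auto simp: sized_simplex_def)
  finally show "norm \<theta> \<le> u" .
qed

text \<open>
  On the simplex one coordinate \<open>i0\<close> is determined by the \<open>k = n - 1\<close> others.
  Cutting the range of each of those into intervals of length \<open>u / m\<close> leaves at most
  \<open>(m + 1) ^ k\<close> cells. Within a cell the free coordinates vary by at most
  \<open>u / m\<close> each, hence \<open>i0\<close> varies by at most \<open>k * u / m\<close>, and the
  diameter is of order \<open>1 / m\<close>.
\<close>

lemma volume_dim_simplex_finite:
  assumes u: "u > 0"
  shows "volume_dim (CARD('n) - 1) (sized_simplex u :: (real ^ 'n) set) < \<infinity>"
proof -
  define k where "k = CARD('n) - 1"
  \<comment> \<open>An arbitrary coordinate, singled out to be expressed through the others.\<close>
  obtain i0 :: 'n where True by blast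
  define J where "J = UNIV - {i0}"
  have J: "finite J" "card J = k" by (auto simp: J_def k_def card_Diff_singleton)
  have splt: "(\<Sum>i\<in>UNIV. h i) = h i0 + (\<Sum>i\<in>J. h i)" for h :: "'n \<Rightarrow> real"
    unfolding J_def by (subst sum.remove[of _ i0]) auto
  have "volume_dim k (sized_simplex u :: (real ^ 'n) set) \<le> ennreal (unit_ball_vol (real k) * (4 * real k * u) ^ k)"
  proof (rule volume_dim_le_of_fine_covers)
    fix \<delta> :: real assume \<delta>: "\<delta> > 0"
    define m where "m = nat \<lceil>2 * real k * u / \<delta>\<rceil> + 1"
    have m: "m > 0" "2 * real k * u / \<delta> \<le> real m"
      by (auto simp: m_def) linarith
    \<comment> \<open>Half of this bound comes from the free coordinates, half from \<open>i0\<close>.\<close>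
    define d where "d = 2 * real k * u / real m"
    define cell where "cell \<phi> = {\<theta> \<in> sized_simplex u :: (real ^ 'n) set.
         \<forall>i\<in>J. real (\<phi> i) * (u / real m) \<le> \<theta> $ i \<and> \<theta> $ i \<le> (real (\<phi> i) + 1) * (u / real m)}"
      for \<phi> :: "'n \<Rightarrow> nat"
    define F where "F = cell ` (Pi\<^sub>E J (\<lambda>_. {0..m}))"
    have "finite F" unfolding F_def using J by (intro finite_imageI finite_PiE) auto
    moreover have "sized_simplex u \<subseteq> \<Union>F"
    proof
      fix \<theta> :: "real ^ 'n" assume \<theta>: "\<theta> \<in> sized_simplex u"
      \<comment> \<open>A coordinate equal to \<open>u\<close> gets index \<open>m\<close>, which is why indices run up to \<open>m\<close> and not \<open>m - 1\<close>.\<close>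
      define \<phi> where "\<phi> = restrict (\<lambda>i. nat \<lfloor>\<theta> $ i / (u / real m)\<rfloor>) J"
      have *: "0 \<le> \<theta> $ i / (u / real m)" "\<theta> $ i / (u / real m) \<le> real m" for i
        using sized_simplex_coord_bounds[OF \<theta>, of i] u m by (auto simp: field_simps)
      have "\<phi> \<in> Pi\<^sub>E J (\<lambda>_. {0..m})"
      proof (rule PiE_I)
        fix i assume "i \<in> J"
        then show "\<phi> i \<in> {0..m}" using *[of i] by (simp add: \<phi>_def) linarith
      qed (auto simp: \<phi>_def)
      moreover have "\<theta> \<in> cell \<phi>"
      proof -
        have "real (\<phi> i) * (u / real m) \<le> \<theta> $ i \<and> \<theta> $ i \<le> (real (\<phi> i) + 1) * (u / real m)" if "i \<in> J" for i
        proof -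
          have "real (\<phi> i) = of_int \<lfloor>\<theta> $ i / (u / real m)\<rfloor>"
            using *[of i] that by (simp add: \<phi>_def)
          then have "real (\<phi> i) \<le> \<theta> $ i / (u / real m)" "\<theta> $ i / (u / real m) \<le> real (\<phi> i) + 1"
            by linarith+
          moreover have "u / real m > 0" using u m by simp
          ultimately show ?thesis using pos_le_divide_eq pos_divide_le_eq by blast
        qed
        then show ?thesis using \<theta> by (auto simp: cell_def)
      qed
      ultimately show "\<theta> \<in> \<Union>F" by (auto simp: F_def)
    qed
    moreover have "d \<le> \<delta>" using m \<delta> u by (simp add: d_def field_simps)
    moreover have "real (card F) * d ^ k \<le> (4 * real k * u) ^ k"
    proof -
      have "card F \<le> (m + 1) ^ k"
        unfolding F_def using J
        by (intro order_trans[OF card_image_le]) (auto intro: finite_PiE simp: card_PiE)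
      also have "\<dots> \<le> (2 * m) ^ k" using m by (intro power_mono) auto
      finally have "real (card F) \<le> (2 * real m) ^ k"
        by (metis of_nat_le_iff of_nat_mult of_nat_numeral of_nat_power)
      then have "real (card F) * d ^ k \<le> (2 * real m) ^ k * d ^ k"
        using u by (intro mult_right_mono) (auto simp: d_def)
      also have "\<dots> = (2 * real m * d) ^ k" by (simp only: power_mult_distrib)
      also have "2 * real m * d = 4 * real k * u" using m by (simp add: d_def)
      finally show ?thesis .
    qed
    moreover have "\<forall>U\<in>F. bounded U \<and> diameter U \<le> d"
    proof
      fix U assume "U \<in> F"
      then obtain \<phi> where U: "U = cell \<phi>" by (auto simp: F_def)
      have "bounded U" using bounded_sized_simplex by (rule bounded_subset) (auto simp: U cell_def)
      moreover have "diameter U \<le> d"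
      proof (rule diameter_le)
        show "U \<noteq> {} \<or> 0 \<le> d" using u by (auto simp: d_def)
        fix x y assume xy: "x \<in> U" "y \<in> U"
        have close: "\<bar>x $ i - y $ i\<bar> \<le> u / real m" if "i \<in> J" for i
        proof -
          have "real (\<phi> i) * (u / real m) \<le> x $ i \<and> x $ i \<le> (real (\<phi> i) + 1) * (u / real m)"
            "real (\<phi> i) * (u / real m) \<le> y $ i \<and> y $ i \<le> (real (\<phi> i) + 1) * (u / real m)"
            using xy that by (auto simp: U cell_def)
          then show ?thesis unfolding distrib_right mult_1_left abs_le_iff by linarith
        qed
        have sums: "(\<Sum>i\<in>J. \<bar>x $ i - y $ i\<bar>) \<le> real k * (u / real m)"
          using sum_bounded_above[of J "\<lambda>i. \<bar>x $ i - y $ i\<bar>" "u / real m"] close J by auto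
        have "x $ i0 + (\<Sum>i\<in>J. x $ i) = y $ i0 + (\<Sum>i\<in>J. y $ i)"
          using xy splt[of "\<lambda>i. x $ i"] splt[of "\<lambda>i. y $ i"] by (auto simp: U cell_def sized_simplex_def)
        then have "\<bar>x $ i0 - y $ i0\<bar> = \<bar>\<Sum>i\<in>J. x $ i - y $ i\<bar>"
          by (simp add: sum_subtractf)
        also have "\<dots> \<le> (\<Sum>i\<in>J. \<bar>x $ i - y $ i\<bar>)" by (rule sum_abs)
        finally have "(\<Sum>i\<in>UNIV. \<bar>x $ i - y $ i\<bar>) \<le> 2 * (real k * (u / real m))"
          using sums splt[of "\<lambda>i. \<bar>x $ i - y $ i\<bar>"] by simp
        then show "norm (x - y) \<le> d"
          using norm_le_l1_cart[of "x - y"] by (simp add: d_def)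
      qed
      ultimately show "bounded U \<and> diameter U \<le> d" by blast
    qed
    ultimately show "\<exists>F d. finite F \<and> (sized_simplex u :: (real ^ 'n) set) \<subseteq> \<Union>F \<and> d \<le> \<delta> \<and> real (card F) * d ^ k \<le> (4 * real k * u) ^ k \<and>
                     (\<forall>U\<in>F. bounded U \<and> diameter U \<le> d)"
      by - (intro exI[of _ F] exI[of _ d] conjI; assumption)
  qed
  also have "\<dots> < \<infinity>" by (simp add: less_top[symmetric])
  finally show ?thesis by (simp only: k_def)
qed

text \<open>
  Lebesgue measure in the ambient space gives the lower bound. Thickening the simplex by the segment
  from 0 to \<open>2 * u\<close> in the direction of one coordinate \<open>i0\<close> yields a set
  that contains a nondegenerate box \<open>Q\<close>. A piece of diameter \<open>d \<le> 1\<close> of a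
  cover of the simplex thickens to a subset of a box with \<open>k\<close> sides of length
  \<open>2 * d\<close> and one side of length \<open>2 * d + 2 * u\<close>. The volume of that box is at
  most a constant \<open>D\<close> times the weight of the piece, so the total weight of a cover is
  bounded below by the measure of \<open>Q\<close> over \<open>D\<close>.
\<close>

lemma volume_dim_simplex_pos:
  assumes u: "u > 0"
  shows "volume_dim (CARD('n) - 1) (sized_simplex u :: (real ^ 'n) set) > 0"
proof -
  define k where "k = CARD('n) - 1"
  \<comment> \<open>An arbitrary coordinate, used as the direction of thickening.\<close>
  obtain i0 :: 'n where True by blast
  define J where "J = UNIV - {i0}"
  have J: "finite J" "card J = k" "i0 \<notin> J" by (auto simp: J_def k_def card_Diff_singleton)
  have UNIV: "(UNIV :: 'n set) = insert i0 J" by (auto simp: J_def)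
  define Q :: "(real ^ 'n) set" where "Q = box (\<chi> i. if i = i0 then u else 0)  (\<chi> i. if i = i0 then 2 * u else u / real CARD('n))"
  have Q_pos: "emeasure lborel Q > 0"
  proof -
    have "Q \<noteq> {}" using u by (auto simp: Q_def interval_ne_empty_cart)
    then have "\<not> negligible Q" unfolding Q_def by (rule open_not_negligible[OF open_box])
    then show ?thesis by (simp add: negligible_iff_null_sets null_sets_def Q_def zero_less_iff_neq_zero
        emeasure_completion)
  qed
  define D where "D = (2 + 2 * u) * 4 ^ k / unit_ball_vol (real k)"
  have D: "D > 0" using u by (auto simp: D_def)
  have ubv: "unit_ball_vol (real k) > 0" by simp
  have "emeasure lborel Q / ennreal D \<le> hausdorff_pre k 1 (sized_simplex u :: (real ^ 'n) set)"
    unfolding hausdorff_pre_def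
  proof (intro INF_greatest)
    fix U :: "nat \<Rightarrow> (real ^ 'n) set"
    assume "U \<in> {U. sized_simplex u \<subseteq> (\<Union>i. U i) \<and> (\<forall>i. bounded (U i) \<and> diameter (U i) \<le> 1)}"
    then have U: "sized_simplex u \<subseteq> (\<Union>i. U i)" "\<And>i. bounded (U i)" "\<And>i. diameter (U i) \<le> 1"
      by auto
    let ?w = "\<lambda>i. if U i = {} then 0 else ennreal (unit_ball_vol (real k) * (diameter (U i) / 2) ^ k)"
    define p where "p i = (SOME x. x \<in> U i)" for i
    have p: "p i \<in> U i" if "U i \<noteq> {}" for i
      using that unfolding p_def by (simp add: some_in_eq)
    define lo hi where
      "lo i = (\<chi> j. p i $ j - diameter (U i))" and
      "hi i = (\<chi> j. p i $ j + diameter (U i) + (if j = i0 then 2 * u else 0))" for i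
    define B where "B i = (if U i = {} then {} else cbox (lo i) (hi i))" for i
    have "Q \<subseteq> (\<Union>i. B i)"
    proof
      fix x assume "x \<in> Q"
      then have x: "u < x $ i0" "x $ i0 < 2 * u" "\<And>j. j \<in> J \<Longrightarrow> 0 < x $ j \<and> x $ j < u / real CARD('n)"
      proof -
        have *: "(if j = i0 then u else 0) < x $ j \<and> x $ j < (if j = i0 then 2 * u else u / real CARD('n))" for j
          using \<open>x \<in> Q\<close> by (simp add: Q_def mem_box_cart)
        show "u < x $ i0" "x $ i0 < 2 * u" using *[of i0] by simp_all
        show "0 < x $ j \<and> x $ j < u / real CARD('n)" if "j \<in> J" for j
          using *[of j] that J(3) by (cases "j = i0") auto
      qed
      define s where "s = (\<Sum>j\<in>J. x $ j)"
      have "s \<ge> 0" unfolding s_def using x(3) by (intro sum_nonneg) (auto intro: less_imp_le)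
      have "s \<le> real k * (u / real CARD('n))"
        using sum_bounded_above[of J "\<lambda>j. x $ j" "u / real CARD('n)"] x(3) J by (auto simp: s_def less_imp_le)
      also have "\<dots> \<le> u" using u by (simp add: k_def field_simps)
      finally have "s \<le> u" .
      \<comment> \<open>The point of the simplex from which \<open>x\<close> is reached by moving along coordinate \<open>i0\<close>.\<close>
      define \<theta> :: "real ^ 'n" where "\<theta> = (\<chi> j. if j = i0 then u - s else x $ j)"
      have "(\<Sum>j\<in>J. \<theta> $ j) = s" unfolding s_def using J(3) by (intro sum.cong) (auto simp: \<theta>_def)
      then have "(\<Sum>j\<in>UNIV. \<theta> $ j) = u" unfolding UNIV using J by (simp add: \<theta>_def)
      moreover have "0 \<le> \<theta> $ j" for j
        using x(3)[of j] \<open>s \<le> u\<close> by (auto simp: \<theta>_def J_def)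
      ultimately have "\<theta> \<in> sized_simplex u" by (auto simp: sized_simplex_def)
      then obtain i where i: "\<theta> \<in> U i" using U(1) by auto
      then have ne: "U i \<noteq> {}" by auto
      have near: "\<bar>\<theta> $ j - p i $ j\<bar> \<le> diameter (U i)" for j
        using component_le_norm_cart[of "\<theta> - p i" j]
          diameter_bounded_bound[OF U(2) i p[OF ne]] by (simp add: dist_norm)
      have "lo i $ j \<le> x $ j \<and> x $ j \<le> hi i $ j" for j
        using near[of j] x(1,2) \<open>0 \<le> s\<close> \<open>s \<le> u\<close>
        by (cases "j = i0") (auto simp: lo_def hi_def \<theta>_def)
      then have "x \<in> B i" using ne by (simp add: B_def mem_box_cart)
      then show "x \<in> (\<Union>i. B i)" by blast
    qed
    then have "emeasure lborel Q \<le> emeasure lborel (\<Union>i. B i)"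
      by (intro emeasure_mono) (auto simp: B_def)
    also have "\<dots> \<le> (\<Sum>i. emeasure lborel (B i))"
      by (intro emeasure_subadditive_countably) (auto simp: B_def)
    also have "\<dots> \<le> (\<Sum>i. ennreal D * ?w i)"
    proof (intro suminf_le allI)
      fix i
      show "emeasure lborel (B i) \<le> ennreal D * ?w i"
      proof (cases "U i = {}")
        case False
        define d where "d = diameter (U i)"
        have d: "0 \<le> d" "d \<le> 1" using U diameter_ge_0 by (auto simp: d_def)
        have "cbox (lo i) (hi i) \<noteq> {}"
          using d u by (simp add: interval_ne_empty_cart lo_def hi_def flip: d_def)
        then have "measure lborel (cbox (lo i) (hi i)) = (\<Prod>j\<in>UNIV. hi i $ j - lo i $ j)"
          by (rule content_cbox_cart)
        also have "\<dots> = (hi i $ i0 - lo i $ i0) * (\<Prod>j\<in>J. hi i $ j - lo i $ j)"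
          unfolding UNIV using J by simp
        also have "(\<Prod>j\<in>J. hi i $ j - lo i $ j) = (\<Prod>j\<in>J. 2 * d)"
          using J(3) by (intro prod.cong) (auto simp: hi_def lo_def d_def)
        also have "hi i $ i0 - lo i $ i0 = 2 * d + 2 * u"
          by (simp add: hi_def lo_def d_def)
        finally have "measure lborel (cbox (lo i) (hi i)) = (2 * d + 2 * u) * (2 * d) ^ k"
          using J by simp
        also have "\<dots> \<le> (2 + 2 * u) * (2 * d) ^ k"
          using d by (intro mult_right_mono) auto
        also have "\<dots> = D * (unit_ball_vol (real k) * (d / 2) ^ k)"
        proof -
          have "(2 * d) ^ k = 4 ^ k * (d / 2) ^ k"
            unfolding power_mult_distrib[symmetric] by simp
          moreover have "D * unit_ball_vol (real k) = (2 + 2 * u) * 4 ^ k"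
            using ubv by (metis D_def nonzero_eq_divide_eq less_irrefl)
          ultimately show ?thesis by (simp flip: mult.assoc)
        qed
        finally have "measure lborel (cbox (lo i) (hi i)) \<le> D * (unit_ball_vol (real k) * (d / 2) ^ k)" .
        moreover have "emeasure lborel (B i) = ennreal (measure lborel (cbox (lo i) (hi i)))"
          using False emeasure_lborel_cbox_finite[of "lo i" "hi i"]
          by (simp only: B_def if_False) (rule emeasure_eq_ennreal_measure, simp)
        ultimately show ?thesis
          using False D by (simp add: ennreal_leI flip: d_def ennreal_mult')
      qed (simp add: B_def)
    qed auto
    also have "\<dots> = ennreal D * (\<Sum>i. ?w i)" by (rule ennreal_suminf_cmult)
    finally show "emeasure lborel Q / ennreal D \<le> (\<Sum>i. ?w i)"
      using D by (intro divide_le_posI_ennreal) (auto simp: mult.commute)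
  qed
  also have "\<dots> \<le> volume_dim k (sized_simplex u :: (real ^ 'n) set)"
    unfolding volume_dim_def by (intro SUP_upper) auto
  finally have "emeasure lborel Q / ennreal D \<le> volume_dim k (sized_simplex u :: (real ^ 'n) set)" .
  moreover have "0 < emeasure lborel Q / ennreal D"
    using Q_pos by (simp add: ennreal_zero_less_divide)
  ultimately show ?thesis unfolding k_def by (rule order.strict_trans2[rotated])
qed

section \<open>Joint tails of the coordinates\<close>

text \<open>
  Subtracting \<open>x\<close> from the coordinates in \<open>A\<close> turns the constraints
  \<open>x \<le> \<theta> $ i\<close> into nonnegativity and lowers the total to
  \<open>u - card A * x\<close>. The set is therefore a smaller simplex, and a homothetic copy of the
  full one.
\<close>

lemma sized_simplex_inter_orthant:
  fixes A :: "'n::finite set"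
  assumes u: "u > 0" and x: "x \<ge> 0" and lt: "real (card A) * x < u"
  shows "{\<theta> \<in> sized_simplex u. \<forall>i\<in>A. x \<le> \<theta> $ i} =
         (\<lambda>\<theta>. (\<chi> i. if i \<in> A then x else 0) + (1 - real (card A) / u * x) *\<^sub>R \<theta>) ` sized_simplex u"
    (is "?C = ?f ` _")
proof -
  define r where "r = 1 - real (card A) / u * x"
  have r: "r > 0" and ru: "real (card A) * x + r * u = u"
    using u lt by (auto simp: r_def field_simps)
  have corner: "(\<Sum>i\<in>UNIV. if i \<in> A then x else 0) = real (card A) * x"
    by (simp flip: sum.inter_filter)
  have f: "?f \<theta> $ i = (if i \<in> A then x else 0) + r * \<theta> $ i" for \<theta> i
    by (simp add: r_def)
  show ?thesis
  proof (intro equalityI subsetI)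
    fix \<theta> assume "\<theta> \<in> ?C"
    then have \<theta>: "(\<Sum>i\<in>UNIV. \<theta> $ i) = u" "\<And>i. 0 \<le> \<theta> $ i" "\<And>i. i \<in> A \<Longrightarrow> x \<le> \<theta> $ i"
      by (auto simp: sized_simplex_def)
    define \<eta> :: "real ^ 'n" where "\<eta> = (\<chi> i. (\<theta> $ i - (if i \<in> A then x else 0)) / r)"
    have "(\<Sum>i\<in>UNIV. \<eta> $ i) = (u - real (card A) * x) / r"
      by (simp only: \<eta>_def vec_lambda_beta sum_subtractf \<theta>(1) corner flip: sum_divide_distrib)
    moreover have "(u - real (card A) * x) / r = u"
      using r ru by (simp add: field_simps)
    ultimately have "(\<Sum>i\<in>UNIV. \<eta> $ i) = u" by simp
    moreover have "0 \<le> \<eta> $ i" for i using \<theta> r by (auto simp: \<eta>_def)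
    ultimately have "\<eta> \<in> sized_simplex u" by (simp add: sized_simplex_def)
    moreover have "\<theta> = ?f \<eta>"
      unfolding vec_eq_iff f using r by (simp add: \<eta>_def)
    ultimately show "\<theta> \<in> ?f ` sized_simplex u" by blast
  next
    fix \<theta> assume "\<theta> \<in> ?f ` sized_simplex u"
    then obtain \<eta> where \<eta>: "\<eta> \<in> sized_simplex u" "\<theta> = ?f \<eta>" by blast
    have "(\<Sum>i\<in>UNIV. \<theta> $ i) = u"
      using \<eta>(1) ru unfolding \<eta>(2) f sum.distrib corner by (simp add: sized_simplex_def flip: sum_distrib_left)
    moreover have "0 \<le> \<theta> $ i" "i \<in> A \<Longrightarrow> x \<le> \<theta> $ i" for i
      using \<eta>(1) r x unfolding \<eta>(2) f by (auto simp: sized_simplex_def)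
    ultimately show "\<theta> \<in> ?C" by (auto simp: sized_simplex_def)
  qed
qed

lemma sized_simplex_borel: "(sized_simplex u :: (real ^ 'n) set) \<in> sets borel"
  unfolding sized_simplex_def by measurable

lemma uniform_on_simplexD:
  fixes \<Theta> :: "'w \<Rightarrow> real ^ 'n"
  assumes "uniform_on_simplex M u \<Theta>" "C \<in> sets borel" "C \<subseteq> sized_simplex u"
  shows "emeasure M {\<omega> \<in> space M. \<Theta> \<omega> \<in> C} =
          volume_dim (CARD('n) - 1) C / volume_dim (CARD('n) - 1) (sized_simplex u :: (real ^ 'n) set)"
  using assms by (simp add: uniform_on_simplex_def)

text \<open>
  The defining quotient for the whole simplex is 1 only because its volume is neither 0 nor
  infinite: in the extended nonnegative reals both degenerate quotients are 0.
\<close>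

lemma uniform_on_simplex_AE:
  fixes \<Theta> :: "'w \<Rightarrow> real ^ 'n"
  assumes "prob_space M" and unif: "uniform_on_simplex M u \<Theta>" and u: "u > 0"
  shows "AE \<omega> in M. \<Theta> \<omega> \<in> sized_simplex u"
proof -
  interpret prob_space M by fact
  let ?V = "volume_dim (CARD('n) - 1) (sized_simplex u :: (real ^ 'n) set)"
  have [measurable]: "\<Theta> \<in> borel_measurable M" using unif by (simp add: uniform_on_simplex_def)
  note sized_simplex_borel[of u, where 'n = 'n, measurable]
  have "emeasure M {\<omega> \<in> space M. \<Theta> \<omega> \<in> sized_simplex u} = ?V / ?V"
    using unif sized_simplex_borel[of u] by (auto simp: uniform_on_simplex_def)
  also have "\<dots> = 1"
    using volume_dim_simplex_pos[OF u, where 'n = 'n] volume_dim_simplex_finite[OF u, where 'n = 'n]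
    by (simp add: ennreal_divide_self less_top)
  finally have "prob {\<omega> \<in> space M. \<Theta> \<omega> \<in> sized_simplex u} = 1"
    by (simp add: measure_def)
  then show ?thesis by (subst (asm) prob_Collect_eq_1) measurable
qed

text \<open>
  The ratio of volumes is the scaling factor of the homothety to the power
  \<open>n - 1\<close>. The boundary value \<open>card A * x = u\<close>, where the set shrinks to one
  point, is left out: only finitely many thresholds \<open>x\<close> are affected, and they are
  invisible to the tail integral.
\<close>

lemma uniform_on_simplex_prob_coords_ge:
  fixes \<Theta> :: "'w \<Rightarrow> real ^ 'n"
  assumes "prob_space M" and unif: "uniform_on_simplex M u \<Theta>" and u: "u > 0" and n: "CARD('n) \<ge> 2"
    and x: "x \<ge> 0" and A: "real (card A) * x \<noteq> u"
  shows "measure M {\<omega> \<in> space M. \<forall>i\<in>A. x \<le> \<Theta> \<omega> $ i} = max 0 (1 - real (card A) / u * x) ^ (CARD('n) - 1)"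
proof -
  interpret prob_space M by fact
  let ?k = "CARD('n) - 1"
  let ?S = "sized_simplex u :: (real ^ 'n) set"
  let ?C = "{\<theta> \<in> ?S. \<forall>i\<in>A. x \<le> \<theta> $ i}"
  have [measurable]: "\<Theta> \<in> borel_measurable M" using unif by (simp add: uniform_on_simplex_def)
  note sized_simplex_borel[of u, where 'n = 'n, measurable]
  have C: "?C \<in> sets borel" by measurable
  have "measure M {\<omega> \<in> space M. \<forall>i\<in>A. x \<le> \<Theta> \<omega> $ i} = measure M {\<omega> \<in> space M. \<Theta> \<omega> \<in> ?C}"
    using uniform_on_simplex_AE[OF assms(1-3)] by (intro finite_measure_eq_AE) (auto, measurable)
  also have "\<dots> = max 0 (1 - real (card A) / u * x) ^ ?k"
  proof (cases "real (card A) * x < u")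
    case True
    define r where "r = 1 - real (card A) / u * x"
    have r: "r > 0" using True u by (simp add: r_def field_simps)
    have "emeasure M {\<omega> \<in> space M. \<Theta> \<omega> \<in> ?C} = volume_dim ?k ?C / volume_dim ?k ?S"
      by (rule uniform_on_simplexD[OF unif C]) auto
    also have "volume_dim ?k ?C = ennreal (r ^ ?k) * volume_dim ?k ?S"
      unfolding sized_simplex_inter_orthant[OF u x True] r_def[symmetric] by (rule volume_dim_affinity[OF r])
    also have "ennreal (r ^ ?k) * volume_dim ?k ?S / volume_dim ?k ?S = ennreal (r ^ ?k)"
      using volume_dim_simplex_pos[OF u, where 'n = 'n] volume_dim_simplex_finite[OF u, where 'n = 'n]
      by (intro mult_divide_eq_ennreal) auto
    finally show ?thesis using r by (simp add: measure_def r_def)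
  next
    case False
    have "?C = {}"
    proof (rule ccontr)
      assume "?C \<noteq> {}"
      then obtain \<theta> where \<theta>: "\<theta> \<in> ?S" "\<And>i. i \<in> A \<Longrightarrow> x \<le> \<theta> $ i" by blast
      have "real (card A) * x \<le> (\<Sum>i\<in>A. \<theta> $ i)" using \<theta>(2) by (intro sum_bounded_below) auto
      also have "\<dots> \<le> (\<Sum>i\<in>UNIV. \<theta> $ i)" using \<theta>(1) by (intro sum_mono2) (auto simp: sized_simplex_def)
      also have "\<dots> = u" using \<theta>(1) by (simp add: sized_simplex_def)
      finally show False using False A by simp
    qed
    then have "measure M {\<omega> \<in> space M. \<Theta> \<omega> \<in> ?C} = 0"
      by (simp only:) simp
    moreover have "max 0 (1 - real (card A) / u * x) = 0" using False u by (simp add: field_simps)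
    ultimately show ?thesis using n by simp
  qed
  finally show ?thesis .
qed

section \<open>The tail of the maximum\<close>

lemma (in prob_space) prob_Union_Incl_Excl:
  assumes "finite A" "\<And>a. a \<in> A \<Longrightarrow> E a \<in> events"
  shows "prob (\<Union>(E ` A)) = (\<Sum>B | B \<subseteq> A \<and> B \<noteq> {}. (-1) ^ (card B + 1) * prob (\<Inter>(E ` B)))"
proof -
  interpret Incl_Excl "\<lambda>S. S \<in> events" prob
    by unfold_locales (auto simp: disjnt_def finite_measure_Union)
  show ?thesis using assms by (intro restricted_indexed) auto
qed

lemma sum_nonempty_subsets_by_card:
  fixes g :: "nat \<Rightarrow> real"
  assumes "finite A"
  shows "(\<Sum>B | B \<subseteq> A \<and> B \<noteq> {}. g (card B)) = (\<Sum>j=1..card A. real (card A choose j) * g j)"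
proof -
  have "(\<Sum>B | B \<subseteq> A \<and> B \<noteq> {}. g (card B)) =
        (\<Sum>j=1..card A. \<Sum>B | B \<in> {B. B \<subseteq> A \<and> B \<noteq> {}} \<and> card B = j. g (card B))"
    using assms by (intro sum.group[symmetric])
      (auto simp: Suc_le_eq card_gt_0_iff finite_subset card_mono)
  also have "\<dots> = (\<Sum>j=1..card A. real (card A choose j) * g j)"
  proof (intro sum.cong refl)
    fix j assume "j \<in> {1..card A}"
    then have "{B. B \<in> {B. B \<subseteq> A \<and> B \<noteq> {}} \<and> card B = j} = {B. B \<subseteq> A \<and> card B = j}" by auto
    then show "(\<Sum>B | B \<in> {B. B \<subseteq> A \<and> B \<noteq> {}} \<and> card B = j. g (card B)) = real (card A choose j) * g j"
      using n_subsets[OF assms, of j] by simp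
  qed
  finally show ?thesis .
qed

lemma max_coord_measurable [measurable]: "max_coord \<in> borel_measurable (borel :: (real ^ 'n) measure)"
  unfolding max_coord_def by (intro borel_measurable_Max) auto

lemma max_coord_ge_iff: "x \<le> max_coord \<theta> \<longleftrightarrow> (\<exists>i. x \<le> \<theta> $ i)"
  by (auto simp: max_coord_def Max_ge_iff)

lemma max_coord_sized_simplex:
  assumes "\<theta> \<in> sized_simplex u"
  shows "0 \<le> max_coord \<theta>" "max_coord \<theta> \<le> u"
  using sized_simplex_coord_bounds[OF assms] by (auto simp: max_coord_ge_iff) (auto simp: max_coord_def)

text \<open>
  The maximum reaches \<open>x\<close> if some coordinate does. Inclusion-exclusion reduces this union
  to the joint tails of subfamilies of coordinates, which depend on the subfamily only through its
  size.
\<close>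

lemma uniform_on_simplex_prob_max_ge:
  fixes \<Theta> :: "'w \<Rightarrow> real ^ 'n"
  assumes "prob_space M" and unif: "uniform_on_simplex M u \<Theta>" and u: "u > 0" and n: "CARD('n) \<ge> 2"
    and x: "x \<ge> 0" and generic: "\<And>j. j \<in> {1..CARD('n)} \<Longrightarrow> real j * x \<noteq> u"
  shows "measure M {\<omega> \<in> space M. x \<le> max_coord (\<Theta> \<omega>)} =
         (\<Sum>j=1..CARD('n). real (CARD('n) choose j) * ((-1) ^ (j - 1) * max 0 (1 - real j / u * x) ^ (CARD('n) - 1)))"
proof -
  interpret prob_space M by fact
  have [measurable]: "\<Theta> \<in> borel_measurable M" using unif by (simp add: uniform_on_simplex_def)
  define E where "E i = {\<omega> \<in> space M. x \<le> \<Theta> \<omega> $ i}" for i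
  have "{\<omega> \<in> space M. x \<le> max_coord (\<Theta> \<omega>)} = \<Union>(E ` UNIV)"
    by (auto simp: E_def max_coord_ge_iff)
  then have "prob {\<omega> \<in> space M. x \<le> max_coord (\<Theta> \<omega>)} =
    (\<Sum>B | B \<subseteq> UNIV \<and> B \<noteq> {}. (-1) ^ (card B + 1) * prob (\<Inter>(E ` B)))"
    using prob_Union_Incl_Excl[of UNIV E] by (simp add: E_def)
  also have "\<dots> = (\<Sum>B | B \<subseteq> (UNIV :: 'n set) \<and> B \<noteq> {}.
      (-1) ^ (card B - 1) * max 0 (1 - real (card B) / u * x) ^ (CARD('n) - 1))"
  proof (intro sum.cong refl)
    fix B :: "'n set" assume "B \<in> {B. B \<subseteq> UNIV \<and> B \<noteq> {}}"
    then have B: "B \<noteq> {}" "card B \<in> {1..CARD('n)}"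
      by (auto simp: Suc_le_eq card_gt_0_iff intro: card_mono)
    then have "\<Inter>(E ` B) = {\<omega> \<in> space M. \<forall>i\<in>B. x \<le> \<Theta> \<omega> $ i}" by (auto simp: E_def)
    moreover have "(-1) ^ (card B + 1) = ((-1) ^ (card B - 1) :: real)"
      using B by (cases "card B") auto
    ultimately show "(-1) ^ (card B + 1) * prob (\<Inter>(E ` B)) =
        (-1) ^ (card B - 1) * max 0 (1 - real (card B) / u * x) ^ (CARD('n) - 1)"
      using uniform_on_simplex_prob_coords_ge[OF assms(1-4) x generic[OF B(2)]] by simp
  qed
  also have "\<dots> = (\<Sum>j=1..CARD('n). real (CARD('n) choose j) * ((-1) ^ (j - 1) * max 0 (1 - real j / u * x) ^ (CARD('n) - 1)))"
    by (rule sum_nonempty_subsets_by_card) simp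
  finally show ?thesis .
qed

section \<open>Moments from tails\<close>

text \<open>
  This is Euler's Beta integral on \<open>[0, 1]\<close>, rescaled by \<open>c\<close> and extended by
  the zero values of the truncated factor beyond \<open>1 / c\<close>. Below it yields the
  \<open>t\<close>-th moment of a random variable with tail \<open>max 0 (1 - c * x) ^ Suc k\<close>.
\<close>

lemma has_integral_truncated_beta:
  fixes c u :: real
  assumes c: "c > 0" and cu: "1 / c \<le> u" and t: "t \<ge> 1"
  shows "((\<lambda>x. real t * x ^ (t - 1) * max 0 (1 - c * x) ^ Suc k) has_integral
           (1 / c) ^ t / real ((Suc k + t) choose t)) {0..u}"
proof -
  have "((\<lambda>x. x powr (real t - 1) * (1 - x) powr (real (k + 2) - 1)) has_integral Beta (real t) (real (k + 2))) {0..1}"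
    using t by (intro has_integral_Beta_real) auto
  then have "((\<lambda>x. real t * (x powr (real t - 1) * (1 - x) powr (real (k + 2) - 1))) has_integral
                real t * Beta (real t) (real (k + 2))) {0..1}"
    by (rule has_integral_mult_right)
  also have "real t * Beta (real t) (real (k + 2)) = 1 / real ((Suc k + t) choose t)"
  proof -
    have 1: "Gamma (real t) = fact (t - 1)" using Gamma_fact[of "t - 1", where 'a = real] t by simp
    have 2: "Gamma (real (k + 2)) = fact (Suc k)" using Gamma_fact[of "Suc k", where 'a = real] by (simp add: add_ac)
    have 3: "Gamma (real t + real (k + 2)) = fact (Suc k + t)"
      using Gamma_fact[of "Suc k + t", where 'a = real] by (simp add: add_ac)
    have 4: "real t * fact (t - 1) = fact t" using t by (subst (2) fact_reduce) auto
    have 5: "real ((Suc k + t) choose t) = fact (Suc k + t) / (fact t * fact (Suc k))"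
      by (subst binomial_fact) auto
    show ?thesis unfolding Beta_def 1 2 3 5 4[symmetric] by simp
  qed
  finally have beta: "((\<lambda>x. real t * (x powr (real t - 1) * (1 - x) powr (real (k + 2) - 1))) has_integral
                1 / real ((Suc k + t) choose t)) {0..1}" .
  have "((\<lambda>x. real t * (x ^ (t - 1) * (1 - x) ^ Suc k)) has_integral 1 / real ((Suc k + t) choose t)) {0..1}"
  \<comment> \<open>For \<open>t = 1\<close> the integrands differ at 0, since \<open>0 powr 0 = 0\<close> while \<open>0 ^ 0 = 1\<close>.\<close>
  proof (rule has_integral_spike_finite[OF _ _ beta, of "{0, 1}"])
    fix x :: real assume "x \<in> {0..1} - {0, 1}"
    then have x: "0 < x" "0 < 1 - x" by auto
    show "real t * (x ^ (t - 1) * (1 - x) ^ Suc k) =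
          real t * (x powr (real t - 1) * (1 - x) powr (real (k + 2) - 1))"
      using t powr_realpow[OF x(1), of "t - 1"] powr_realpow[OF x(2), of "Suc k"] by (simp add: of_nat_diff)
  qed auto
  from has_integral_stretch_real[OF this, of c]
  have "((\<lambda>x. real t * ((c * x) ^ (t - 1) * (1 - c * x) ^ Suc k)) has_integral
          1 / c * (1 / real ((Suc k + t) choose t))) ((\<lambda>x. x / c) ` {0..1})"
    using c by simp
  also have "(\<lambda>x. x / c) ` {0..1} = {0..1 / c}"
    using c image_divide_atLeastAtMost[of c 0 1] by simp
  finally have "((\<lambda>x. (1 / c) ^ (t - 1) * (real t * ((c * x) ^ (t - 1) * (1 - c * x) ^ Suc k))) has_integral
          (1 / c) ^ (t - 1) * (1 / c * (1 / real ((Suc k + t) choose t)))) {0..1 / c}"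
    by (rule has_integral_mult_right)
  also have "(1 / c) ^ (t - 1) * (1 / c * (1 / real ((Suc k + t) choose t))) = (1 / c) ^ t / real ((Suc k + t) choose t)"
    using t by (cases t) (auto simp: field_simps)
  finally have "((\<lambda>x. real t * x ^ (t - 1) * max 0 (1 - c * x) ^ Suc k) has_integral
          (1 / c) ^ t / real ((Suc k + t) choose t)) {0..1 / c}"
  proof (rule has_integral_eq[rotated])
    fix x assume "x \<in> {0..1 / c}"
    then have "max 0 (1 - c * x) = 1 - c * x" using c by (simp add: field_simps)
    moreover have "(1 / c) ^ (t - 1) * (c * x) ^ (t - 1) = x ^ (t - 1)"
      using c by (simp flip: power_mult_distrib)
    moreover have "(1 / c) ^ (t - 1) * (real t * ((c * x) ^ (t - 1) * y)) =
        real t * ((1 / c) ^ (t - 1) * (c * x) ^ (t - 1)) * y" for y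
      by (simp only: mult_ac)
    ultimately show "(1 / c) ^ (t - 1) * (real t * ((c * x) ^ (t - 1) * (1 - c * x) ^ Suc k)) =
        real t * x ^ (t - 1) * max 0 (1 - c * x) ^ Suc k"
      by simp
  qed
  moreover have "((\<lambda>x. real t * x ^ (t - 1) * max 0 (1 - c * x) ^ Suc k) has_integral 0) {1 / c..u}"
  proof (rule has_integral_is_0)
    fix x assume "x \<in> {1 / c..u}"
    then have "max 0 (1 - c * x) = 0" using c by (simp add: field_simps)
    then show "real t * x ^ (t - 1) * max 0 (1 - c * x) ^ Suc k = 0" by simp
  qed
  ultimately have "((\<lambda>x. real t * x ^ (t - 1) * max 0 (1 - c * x) ^ Suc k) has_integral
           (1 / c) ^ t / real ((Suc k + t) choose t) + 0) {0..u}"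
    using c cu by (intro has_integral_combine[of 0 "1 / c" u]) auto
  then show ?thesis by simp
qed

text \<open>
  The layer-cake formula: \<open>X ^ t\<close> is the integral of \<open>t * x ^ (t - 1)\<close> over
  \<open>0 \<le> x \<le> X\<close>, and Tonelli's theorem exchanges this integral with the expectation.
\<close>

lemma (in prob_space) expectation_power_eq_tail_integral:
  assumes X [measurable]: "random_variable borel X"
    and bounds: "AE \<omega> in M. 0 \<le> X \<omega> \<and> X \<omega> \<le> u"
    and t: "t \<ge> 1"
    and I: "((\<lambda>x. real t * x ^ (t - 1) * prob {\<omega> \<in> space M. x \<le> X \<omega>}) has_integral I) {0..u}"
  shows "expectation (\<lambda>\<omega>. X \<omega> ^ t) = I"
proof -
  let ?d = "\<lambda>x::real. real t * x ^ (t - 1)"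
  have pow: "ennreal (X \<omega> ^ t) = (\<integral>\<^sup>+x. ennreal (?d x) * indicator {0..u} x * indicator {x. x \<le> X \<omega>} x \<partial>lborel)"
    if "0 \<le> X \<omega> \<and> X \<omega> \<le> u" for \<omega>
  proof -
    have "(?d has_integral X \<omega> ^ t - 0 ^ t) {0..X \<omega>}"
      using that by (intro fundamental_theorem_of_calculus)
        (auto intro!: derivative_eq_intros simp flip: has_real_derivative_iff_has_vector_derivative)
    then have "(\<integral>\<^sup>+x. ennreal (?d x) * indicator {0..X \<omega>} x \<partial>lborel) = ennreal (X \<omega> ^ t)"
      using t nn_integral_has_integral_lebesgue'[of "{0..X \<omega>}" ?d "X \<omega> ^ t"] by (auto simp: power_0_left)
    also have "(\<integral>\<^sup>+x. ennreal (?d x) * indicator {0..X \<omega>} x \<partial>lborel) =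
               (\<integral>\<^sup>+x. ennreal (?d x) * indicator {0..u} x * indicator {x. x \<le> X \<omega>} x \<partial>lborel)"
      using that by (intro nn_integral_cong) (auto simp: indicator_def)
    finally show ?thesis ..
  qed
  interpret pair_sigma_finite lborel M by unfold_locales
  have "(\<integral>\<^sup>+\<omega>. ennreal (X \<omega> ^ t) \<partial>M) =
        (\<integral>\<^sup>+\<omega>. \<integral>\<^sup>+x. ennreal (?d x) * indicator {0..u} x * indicator {x. x \<le> X \<omega>} x \<partial>lborel \<partial>M)"
    using bounds by (intro nn_integral_cong_AE) (auto simp: pow)
  also have "\<dots> = (\<integral>\<^sup>+x. \<integral>\<^sup>+\<omega>. ennreal (?d x) * indicator {0..u} x * indicator {x. x \<le> X \<omega>} x \<partial>M \<partial>lborel)"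
    by (rule Fubini') (simp add: indicator_def, measurable)
  also have "\<dots> = (\<integral>\<^sup>+x. ennreal (?d x * prob {\<omega> \<in> space M. x \<le> X \<omega>}) * indicator {0..u} x \<partial>lborel)"
  proof (intro nn_integral_cong)
    fix x :: real
    have "(\<integral>\<^sup>+\<omega>. ennreal (?d x) * indicator {0..u} x * indicator {x. x \<le> X \<omega>} x \<partial>M) =
          (\<integral>\<^sup>+\<omega>. ennreal (?d x) * indicator {0..u} x * indicator {\<omega> \<in> space M. x \<le> X \<omega>} \<omega> \<partial>M)"
      by (intro nn_integral_cong) (auto simp: indicator_def)
    also have "\<dots> = ennreal (?d x) * indicator {0..u} x * emeasure M {\<omega> \<in> space M. x \<le> X \<omega>}"
      by (subst nn_integral_cmult_indicator) auto
    also have "\<dots> = ennreal (?d x * prob {\<omega> \<in> space M. x \<le> X \<omega>}) * indicator {0..u} x"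
      by (auto simp: indicator_def emeasure_eq_measure ennreal_mult'')
    finally show "(\<integral>\<^sup>+\<omega>. ennreal (?d x) * indicator {0..u} x * indicator {x. x \<le> X \<omega>} x \<partial>M) =
        ennreal (?d x * prob {\<omega> \<in> space M. x \<le> X \<omega>}) * indicator {0..u} x" .
  qed
  also have "\<dots> = ennreal I"
    by (intro nn_integral_has_integral_lebesgue' I) auto
  finally have "(\<integral>\<^sup>+\<omega>. ennreal (X \<omega> ^ t) \<partial>M) = ennreal I" .
  moreover have "0 \<le> I"
    by (rule has_integral_nonneg[OF I]) auto
  moreover have "AE \<omega> in M. 0 \<le> X \<omega> ^ t"
    using bounds by eventually_elim auto
  ultimately show ?thesis
    by (simp add: integral_eq_nn_integral)
qed

text \<open>
  The tail of the maximum is a signed sum of truncated powers, and each of them contributes a Beta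
  integral \<open>(u / j) ^ t / ((n - 1 + t) choose t)\<close> to the moment.
\<close>

lemma uniform_on_simplex_expectation_max_power:
  fixes \<Theta> :: "'w \<Rightarrow> real ^ 'n"
  assumes "prob_space M" and unif: "uniform_on_simplex M u \<Theta>" and u: "u > 0" and n: "CARD('n) \<ge> 2"
    and t: "t \<ge> 1"
  shows "prob_space.expectation M (\<lambda>\<omega>. max_coord (\<Theta> \<omega>) ^ t) =
         u ^ t / real ((CARD('n) - 1 + t) choose t) * alt_binom_sum (CARD('n)) t"
proof -
  interpret prob_space M by fact
  have [measurable]: "\<Theta> \<in> borel_measurable M" using unif by (simp add: uniform_on_simplex_def)
  obtain k where k: "CARD('n) - 1 = Suc k" using n by (cases "CARD('n) - 1") auto
  define I where "I = (\<Sum>j=1..CARD('n). real (CARD('n) choose j) * (-1) ^ (j - 1) *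
     ((1 / (real j / u)) ^ t / real ((Suc k + t) choose t)))"
  have "expectation (\<lambda>\<omega>. max_coord (\<Theta> \<omega>) ^ t) = I"
  proof (rule expectation_power_eq_tail_integral[where u = u, OF _ _ t])
    show "AE \<omega> in M. 0 \<le> max_coord (\<Theta> \<omega>) \<and> max_coord (\<Theta> \<omega>) \<le> u"
      using uniform_on_simplex_AE[OF assms(1-3)] by eventually_elim (auto simp: max_coord_sized_simplex)
    have "((\<lambda>x. \<Sum>j=1..CARD('n). real (CARD('n) choose j) * (-1) ^ (j - 1) *
              (real t * x ^ (t - 1) * max 0 (1 - real j / u * x) ^ Suc k)) has_integral I) {0..u}"
      unfolding I_def
    proof (intro has_integral_sum has_integral_mult_right has_integral_truncated_beta)
      fix j assume "j \<in> {1..CARD('n)}"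
      then show "0 < real j / u" "1 / (real j / u) \<le> u" using u by (auto simp: field_simps)
    qed (use t in auto)
    \<comment> \<open>The tail formula may fail at the thresholds \<open>u / j\<close>, a finite set.\<close>
    then show "((\<lambda>x. real t * x ^ (t - 1) * prob {\<omega> \<in> space M. x \<le> max_coord (\<Theta> \<omega>)}) has_integral I) {0..u}"
    proof (rule has_integral_spike_finite[where S = "(\<lambda>j. u / real j) ` {1..CARD('n)}", rotated 2])
      fix x assume x: "x \<in> {0..u} - (\<lambda>j. u / real j) ` {1..CARD('n)}"
      have "real j * x \<noteq> u" if "j \<in> {1..CARD('n)}" for j
        using x that by (auto simp: field_simps image_iff)
      then have "prob {\<omega> \<in> space M. x \<le> max_coord (\<Theta> \<omega>)} = (\<Sum>j=1..CARD('n). real (CARD('n) choose j) *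
            ((-1) ^ (j - 1) * max 0 (1 - real j / u * x) ^ Suc k))"
        using x uniform_on_simplex_prob_max_ge[OF assms(1-4), of x] unfolding k by simp
      then show "real t * x ^ (t - 1) * prob {\<omega> \<in> space M. x \<le> max_coord (\<Theta> \<omega>)} =
         (\<Sum>j=1..CARD('n). real (CARD('n) choose j) * (-1) ^ (j - 1) *
              (real t * x ^ (t - 1) * max 0 (1 - real j / u * x) ^ Suc k))"
        by (simp only: sum_distrib_left mult_ac)
    qed simp
  qed measurable
  also have "I = u ^ t / real ((CARD('n) - 1 + t) choose t) * alt_binom_sum (CARD('n)) t"
    unfolding I_def alt_binom_sum_def k sum_distrib_left
    by (intro sum.cong) (auto simp: power_divide field_simps)
  finally show ?thesis .
qed

section \<open>Alternating binomial sums\<close>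

lemma alt_binom_sum_0: "n > 0 \<Longrightarrow> alt_binom_sum n 0 = 1"
proof -
  assume n: "n > 0"
  have "(\<Sum>k\<le>n. (-1) ^ k * of_nat (n choose k) :: real) = 0"
    using choose_alternating_sum[OF n] .
  also have "{..n} = insert 0 {1..n}" by auto
  finally have "1 + (\<Sum>k=1..n. (-1) ^ k * of_nat (n choose k) :: real) = 0" by simp
  moreover have "(\<Sum>k=1..n. (-1) ^ (k - 1) * real (n choose k)) = - (\<Sum>k=1..n. (-1) ^ k * of_nat (n choose k) :: real)"
    unfolding sum_negf[symmetric] by (intro sum.cong) (auto simp: power_eq_if)
  ultimately show ?thesis by (simp add: alt_binom_sum_def)
qed

text \<open>
  Pascal's rule splits off the sum for \<open>n\<close>. The remaining coefficients are
  \<open>n choose (k - 1)\<close>, which by absorption is \<open>k / (n + 1)\<close> times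
  \<open>(n + 1) choose k\<close>; the factor \<open>k\<close> lowers the exponent \<open>t\<close> by
  one. Unrolling the recursion gives harmonic numbers for \<open>t = 1\<close> and their symmetric
  quadratic combination for \<open>t = 2\<close>.
\<close>

lemma alt_binom_sum_Suc_Suc:
  "alt_binom_sum (Suc n) (Suc t) = alt_binom_sum n (Suc t) + alt_binom_sum (Suc n) t / real (Suc n)"
proof -
  have "alt_binom_sum n (Suc t) = (\<Sum>k=1..Suc n. (-1) ^ (k - 1) * real (n choose k) * (1 / real k ^ Suc t))"
    by (simp add: alt_binom_sum_def)
  moreover have "(-1) ^ (k - 1) * real (Suc n choose k) * (1 / real k ^ Suc t) =
     (-1) ^ (k - 1) * real (n choose k) * (1 / real k ^ Suc t) +
     (-1) ^ (k - 1) * real (Suc n choose k) * (1 / real k ^ t) / real (Suc n)" if k: "k \<in> {1..Suc n}" for k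
  proof -
    obtain j where j: "k = Suc j" using k by (cases k) auto
    have pascal: "real (Suc n choose k) = real (n choose k) + real (n choose j)"
      by (simp add: j)
    have "real k * real (Suc n choose k) = real (Suc n) * real (n choose j)"
      unfolding j by (metis Suc_times_binomial_eq of_nat_mult mult.commute)
    then have absorb: "real (Suc n choose k) / real (Suc n) = real (n choose j) / real k"
      using k by (simp add: field_simps del: of_nat_Suc binomial_Suc_Suc)
    have "(-1) ^ (k - 1) * real (Suc n choose k) * (1 / real k ^ t) / real (Suc n)
        = (-1) ^ (k - 1) * (real (Suc n choose k) / real (Suc n)) * (1 / real k ^ t)" by simp
    also have "\<dots> = (-1) ^ (k - 1) * real (n choose j) * (1 / real k ^ Suc t)"
      unfolding absorb by simp
    finally show ?thesis
      unfolding pascal by (simp only: distrib_left distrib_right)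
  qed
  ultimately show ?thesis
    unfolding alt_binom_sum_def[of "Suc n"] by (simp only: sum.distrib sum_divide_distrib cong: sum.cong)
qed

lemma alt_binom_sum_1: "alt_binom_sum n 1 = (\<Sum>k=1..n. 1 / real k)"
proof (induction n)
  case (Suc n)
  then show ?case using alt_binom_sum_Suc_Suc[of n 0] by (simp add: alt_binom_sum_0)
qed (simp add: alt_binom_sum_def)

lemma alt_binom_sum_2:
  "alt_binom_sum n 2 = ((\<Sum>k=1..n. 1 / real k)\<^sup>2 + (\<Sum>k=1..n. 1 / real k ^ 2)) / 2"
proof (induction n)
  case (Suc n)
  define H where "H = (\<Sum>k=1..n. 1 / real k)"
  define a where "a = 1 / real (Suc n)"
  have S: "(\<Sum>k=1..Suc n. 1 / real k) = H + a" by (simp add: H_def a_def)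
  have "alt_binom_sum (Suc n) 2 = alt_binom_sum n 2 + (H + a) * a"
    using alt_binom_sum_Suc_Suc[of n 1] alt_binom_sum_1[of "Suc n"] S
    by (simp add: a_def numeral_2_eq_2)
  moreover have "(\<Sum>k=1..Suc n. 1 / real k ^ 2) = (\<Sum>k=1..n. 1 / real k ^ 2) + a\<^sup>2"
    by (simp add: a_def power_divide)
  ultimately show ?case
    unfolding S Suc.IH H_def[symmetric] by (simp add: power2_eq_square field_simps)
qed (simp add: alt_binom_sum_def)

section \<open>Moments, mean and variance of the maximum\<close>

theorem theorem5p7:
  fixes M :: "'w measure" and \<Theta> :: "'w \<Rightarrow> real ^ 'n" and n t :: nat and u :: real
  assumes "prob_space M"
    and "n = CARD('n)" and "n \<ge> 2" and "u > 0" and "t \<ge> 1"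
    and "uniform_on_simplex M u \<Theta>"
  shows "prob_space.expectation M (\<lambda>\<omega>. max_coord (\<Theta> \<omega>) ^ t) =
           u ^ t / real ((n - 1 + t) choose t) * alt_binom_sum n t \<and>
         prob_space.expectation M (\<lambda>\<omega>. max_coord (\<Theta> \<omega>)) =
           u / real n * (\<Sum>k=1..n. 1 / real k) \<and>
         prob_space.variance M (\<lambda>\<omega>. max_coord (\<Theta> \<omega>)) =
           u\<^sup>2 / (real n ^ 2 * (real n + 1)) *
             (real n * (\<Sum>k=1..n. 1 / real k ^ 2) - (\<Sum>k=1..n. 1 / real k)\<^sup>2)"
proof -
  interpret prob_space M by fact
  have [measurable]: "\<Theta> \<in> borel_measurable M" using assms by (simp add: uniform_on_simplex_def)
  define X where "X = (\<lambda>\<omega>. max_coord (\<Theta> \<omega>))"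
  have [measurable]: "X \<in> borel_measurable M" unfolding X_def by measurable
  define H where "H = (\<Sum>k=1..n. 1 / real k)"
  define Q where "Q = (\<Sum>k=1..n. 1 / real k ^ 2)"
  have moment: "expectation (\<lambda>\<omega>. X \<omega> ^ s) = u ^ s / real ((n - 1 + s) choose s) * alt_binom_sum n s"
    if "s \<ge> 1" for s
    using uniform_on_simplex_expectation_max_power[of M u \<Theta> s] assms that by (simp add: X_def)
  have choose1: "real ((n - 1 + 1) choose 1) = real n" using assms by simp
  have "real ((n - 1 + 2) choose 2) = real (Suc n choose 2)" using assms by (simp add: Suc_diff_le)
  also have "\<dots> = real n * (real n + 1) / 2"
    by (simp add: choose_two real_of_nat_div algebra_simps)
  finally have choose2: "real ((n - 1 + 2) choose 2) = real n * (real n + 1) / 2" .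
  have mean: "expectation X = u / real n * H"
    using moment[of 1] by (simp only: choose1 alt_binom_sum_1 H_def power_one_right order_refl)
  have second: "expectation (\<lambda>\<omega>. X \<omega> ^ 2) = u\<^sup>2 / (real n * (real n + 1)) * (H\<^sup>2 + Q)"
    using moment[of 2] unfolding choose2 alt_binom_sum_2 H_def Q_def by simp
  have bounds: "AE \<omega> in M. 0 \<le> X \<omega> \<and> X \<omega> \<le> u"
    using uniform_on_simplex_AE[of M u \<Theta>] assms unfolding X_def
    by (auto elim!: eventually_mono simp: max_coord_sized_simplex)
  have "integrable M X"
  proof (rule integrable_const_bound[of _ u])
    show "AE \<omega> in M. norm (X \<omega>) \<le> u"
      using bounds by eventually_elim simp
  qed measurable
  moreover have "integrable M (\<lambda>\<omega>. X \<omega> ^ 2)"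
  proof (rule integrable_const_bound[of _ "u ^ 2"])
    show "AE \<omega> in M. norm (X \<omega> ^ 2) \<le> u ^ 2"
      using bounds by eventually_elim (simp add: power_mono)
  qed measurable
  ultimately have "variance X = u\<^sup>2 / (real n * (real n + 1)) * (H\<^sup>2 + Q) - (u / real n * H)\<^sup>2"
    using variance_eq[of X] by (simp add: mean second)
  also have "\<dots> = u\<^sup>2 / (real n ^ 2 * (real n + 1)) * (real n * Q - H\<^sup>2)"
  proof -
    have "real n \<noteq> 0" "real n + 1 \<noteq> 0" using \<open>n \<ge> 2\<close> by linarith+
    then show ?thesis
      by (simp add: divide_simps) (simp add: algebra_simps power2_eq_square)
  qed
  finally show ?thesis
    using moment[OF \<open>t \<ge> 1\<close>] mean unfolding X_def H_def Q_def by blast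
qed

end
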